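(* Let $(\Omega, (\mathcal{F}_n)_{n\ge 0}, \mathbb{P})$ be a filtered probability space and let $f$ be a measurable function on $\Omega$ with $0\le f\le 1$. Then there exists a measurable function $m:\Omega\to[0,1]$ such that $$\mathbb{E}(mf)\ge e^{-\|f\|_\infty}\,\mathbb{E} f$$ and $$\sigma(mf)^2\le 18\quad\text{almost everywhere on } \Omega,$$ where $\sigma(g)=\big(\sum_{n\ge 1}\mathbb{E}_{n-1}|\Delta_n g|^2\big)^{1/2}$ is the conditional square function.
   Context: $(\Omega,\mathcal{F},\mathbb{P})$ is a (standard) probability space with a discrete-time filtration $(\mathcal{F}_n)_{n\ge 0}$ (an increasing sequence of sub-sigma-algebras of $\mathcal{F}$, otherwise arbitrary). Standing assumptions: $\bigcup_{n\ge 0}\mathcal{F}_n$ generates $\mathcal{F}$, and $\mathcal{F}_0=\{\emptyset,\Omega\}$. $\mathbb{E}$ denotes expectation, $\mathbb{E}_n=\mathbb{E}(\,\cdot\,|\mathcal{F}_n)$ is the conditional expectation operator, and $\Delta_n=\mathbb{E}_n-\mathbb{E}_{n-1}$ for $n\ge 1$. For $g\in L^2(\Omega)$ the conditional square function is $\sigma(g)=\big(\sum_{n\ge 1}\mathbb{E}_{n-1}|\Delta_n g|^2\big)^{1/2}$. $\|\cdot\|_\infty$ is the $L^\infty(\Omega)$ norm. *)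

theory Defs
  imports "HOL-Probability.Probability"
begin

locale filtered_prob_space =
  prob_space M + filtration "space M" F
  for M :: "'a measure" and F :: "nat \<Rightarrow> 'a measure" +
  assumes sets_F_subset: "\<And>n. sets (F n) \<subseteq> sets M"
    and sets_F_0: "sets (F 0) = {{}, space M}"
    and sets_F_generate: "sigma_sets (space M) (\<Union>n. sets (F n)) = sets M"

(* Meaningful for n >= 1 only; at n = 0 it degenerates to 0 by truncated subtraction. *)
definition mart_diff ::
  "'a measure \<Rightarrow> (nat \<Rightarrow> 'a measure) \<Rightarrow> nat \<Rightarrow> ('a \<Rightarrow> real) \<Rightarrow> 'a \<Rightarrow> real"
  where "mart_diff M F n g x = real_cond_exp M (F n) g x - real_cond_exp M (F (n - 1)) g x"

definition ennreal_sqrt :: "ennreal \<Rightarrow> ennreal"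
  where "ennreal_sqrt t = (if t = \<top> then \<top> else ennreal (sqrt (enn2real t)))"

(* The series over n >= 1 is reindexed by n = Suc k. It is summed in ennreal,
   so that divergence yields the value infinity. *)
definition cond_square_fun ::
  "'a measure \<Rightarrow> (nat \<Rightarrow> 'a measure) \<Rightarrow> ('a \<Rightarrow> real) \<Rightarrow> 'a \<Rightarrow> ennreal"
  where "cond_square_fun M F g x =
    ennreal_sqrt (\<Sum>k. nn_cond_exp M (F k) (\<lambda>y. ennreal (\<bar>mart_diff M F (Suc k) g y\<bar>\<^sup>2)) x)"

(* The essential supremum needs a complete linear order, hence the detour through ereal.
   The real value is the norm only for essentially bounded g (otherwise it is 0). *)
definition Linf_norm :: "'a measure \<Rightarrow> ('a \<Rightarrow> real) \<Rightarrow> real"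
  where "Linf_norm M g = real_of_ereal (esssup M (\<lambda>x. ereal \<bar>g x\<bar>))"

end

theory Submission
  imports Defs
begin

text \<open>
  The idea is to damp \<open>f\<close> by a predictable decreasing weight that pays for the square function out of
  its own decay. Let \<open>\<phi> t = t - t\<^sup>2 / 4\<close> and let \<open>q n\<close> be the quasi-arithmetic mean with
  \<open>\<phi> (q n) = E n (\<phi> \<circ> f)\<close>. As \<open>\<phi>\<close> is concave, \<open>q\<close> is a submartingale: \<open>q n \<le> \<mu> n\<close> for
  \<open>\<mu> n = E n (q (n + 1))\<close>. As \<open>\<phi>\<close> is even strongly concave, the gap \<open>\<mu> n - q n\<close> is at least a quarter of
  the conditional variance of \<open>q (n + 1)\<close> (lemma \<open>cond_variance_le_jensen_gap\<close>).

  Let \<open>w n\<close> be the product of the ratios \<open>q i / \<mu> i\<close> for \<open>i < n\<close>. These weights lie in the unit interval,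
  decrease in \<open>n\<close>, are predictable, and make \<open>w n * q n\<close> a martingale. Its increments are
  \<open>w (n + 1) * (q (n + 1) - \<mu> n)\<close>, whose conditional square is at most
  \<open>4 * (w (n + 1))\<^sup>2 * (\<mu> n - q n) = 4 * w (n + 1) * q n * (w n - w (n + 1)) \<le> 4 * (w n - w (n + 1))\<close>.
  The sum telescopes, so the square of the conditional square function is at most 4.

  The multiplier is the limit of the weights. By the convergence of \<open>E n (\<phi> \<circ> f)\<close> to \<open>\<phi> \<circ> f\<close> in the mean
  (lemma \<open>L1_martingale_convergence\<close>) and the invertibility of \<open>\<phi>\<close> on the unit interval, \<open>q n\<close> tends to \<open>f\<close>,
  and so the martingale \<open>w n * q n\<close> is exactly the sequence of conditional expectations of the multiplier
  times \<open>f\<close> (lemma \<open>cond_exp_product\<close>). In particular that product has the same mean as \<open>q 0\<close>, which is at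
  least the mean of \<open>\<phi> (q 0)\<close>, that is, of \<open>\<phi> \<circ> f\<close>; and \<open>\<phi> t \<ge> exp (- a) * t\<close> for \<open>0 \<le> t \<le> a \<le> 1\<close>.
\<close>

section \<open>Martingale convergence in the mean\<close>

context filtered_prob_space
begin

sublocale cond: finite_measure_subalgebra M "F n" for n
  by unfold_locales (simp add: subalgebra_def space_F sets_F_subset)

abbreviation E :: "nat \<Rightarrow> ('a \<Rightarrow> real) \<Rightarrow> 'a \<Rightarrow> real"
  where "E n \<equiv> real_cond_exp M (F n)"

lemma measurable_F_M: "X \<in> measurable (F n) N \<Longrightarrow> X \<in> measurable M N"
  by (rule measurable_from_subalg[OF cond.subalg])

lemma measurable_F_mono: "X \<in> measurable (F k) N \<Longrightarrow> k \<le> n \<Longrightarrow> X \<in> measurable (F n) N"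
  by (rule measurable_from_subalg[of "F n" "F k"]) (simp_all add: subalgebra_def space_F sets_F_mono)

lemma integrable_unit_interval:
  fixes X :: "'a \<Rightarrow> real"
  assumes "X \<in> borel_measurable M" "AE x in M. 0 \<le> X x \<and> X x \<le> 1"
  shows "integrable M X"
  by (rule integrable_const_bound[where B=1]) (use assms in auto)

lemma cond_exp_L1_contraction:
  assumes [measurable, simp]: "integrable M X"
  shows "(\<integral>x. \<bar>E n X x\<bar> \<partial>M) \<le> (\<integral>x. \<bar>X x\<bar> \<partial>M)"
proof -
  have "AE x in M. E n X x \<le> E n (\<lambda>x. \<bar>X x\<bar>) x"
    by (rule cond.real_cond_exp_mono) auto
  moreover have "AE x in M. E n (\<lambda>x. - 1 * X x) x \<le> E n (\<lambda>x. \<bar>X x\<bar>) x"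
    by (rule cond.real_cond_exp_mono) auto
  moreover have "AE x in M. E n (\<lambda>x. - 1 * X x) x = - 1 * E n X x"
    by (rule cond.real_cond_exp_cmult) auto
  ultimately have "AE x in M. \<bar>E n X x\<bar> \<le> E n (\<lambda>x. \<bar>X x\<bar>) x"
    by eventually_elim auto
  then have "(\<integral>x. \<bar>E n X x\<bar> \<partial>M) \<le> (\<integral>x. E n (\<lambda>x. \<bar>X x\<bar>) x \<partial>M)"
    by (intro integral_mono_AE integrable_abs cond.real_cond_exp_int) auto
  also have "\<dots> = (\<integral>x. \<bar>X x\<bar> \<partial>M)"
    by (intro cond.real_cond_exp_int) auto
  finally show ?thesis .
qed

text \<open>
  Because conditioning is an \<open>L\<^sup>1\<close> contraction, the distance of \<open>X\<close> from its projection changes by at most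
  twice the distance when \<open>X\<close> is perturbed, uniformly in \<open>n\<close>. This is what lets the convergence theorem
  pass to limits in the next lemma.
\<close>
lemma cond_exp_approx_error:
  assumes [measurable, simp]: "integrable M X" "integrable M Z"
  shows "(\<integral>x. \<bar>X x - E n X x\<bar> \<partial>M) \<le> 2 * (\<integral>x. \<bar>X x - Z x\<bar> \<partial>M) + (\<integral>x. \<bar>Z x - E n Z x\<bar> \<partial>M)"
proof -
  have int: "integrable M (E n X)" "integrable M (E n Z)" "integrable M (E n (\<lambda>x. X x - Z x))"
    by (auto intro!: cond.real_cond_exp_int)
  have "AE x in M. E n (\<lambda>x. X x - Z x) x = E n X x - E n Z x"
    by (rule cond.real_cond_exp_diff) auto
  then have "AE x in M. \<bar>X x - E n X x\<bar> \<le> \<bar>X x - Z x\<bar> + \<bar>E n (\<lambda>x. X x - Z x) x\<bar> + \<bar>Z x - E n Z x\<bar>"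
    by eventually_elim auto
  then have "(\<integral>x. \<bar>X x - E n X x\<bar> \<partial>M)
      \<le> (\<integral>x. \<bar>X x - Z x\<bar> + \<bar>E n (\<lambda>x. X x - Z x) x\<bar> + \<bar>Z x - E n Z x\<bar> \<partial>M)"
    using int by (intro integral_mono_AE) auto
  also have "\<dots> = (\<integral>x. \<bar>X x - Z x\<bar> \<partial>M) + (\<integral>x. \<bar>E n (\<lambda>x. X x - Z x) x\<bar> \<partial>M) + (\<integral>x. \<bar>Z x - E n Z x\<bar> \<partial>M)"
    using int by simp
  also have "(\<integral>x. \<bar>E n (\<lambda>x. X x - Z x) x\<bar> \<partial>M) \<le> (\<integral>x. \<bar>X x - Z x\<bar> \<partial>M)"
    by (rule cond_exp_L1_contraction) auto
  finally show ?thesis by simp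
qed

lemma L1_convergence_closed:
  fixes X :: "'a \<Rightarrow> real" and Z :: "nat \<Rightarrow> 'a \<Rightarrow> real"
  assumes X: "integrable M X" and Z: "\<And>i. integrable M (Z i)"
    and conv: "(\<lambda>i. \<integral>x. \<bar>X x - Z i x\<bar> \<partial>M) \<longlonglongrightarrow> 0"
    and step: "\<And>i. (\<lambda>n. \<integral>x. \<bar>Z i x - E n (Z i) x\<bar> \<partial>M) \<longlonglongrightarrow> 0"
  shows "(\<lambda>n. \<integral>x. \<bar>X x - E n X x\<bar> \<partial>M) \<longlonglongrightarrow> 0"
proof (rule LIMSEQ_I)
  fix e :: real assume "0 < e"
  then obtain i where i: "norm ((\<integral>x. \<bar>X x - Z i x\<bar> \<partial>M) - 0) < e / 4"
    using LIMSEQ_D[OF conv, of "e / 4"] by auto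
  obtain N where N: "\<And>n. n \<ge> N \<Longrightarrow> norm ((\<integral>x. \<bar>Z i x - E n (Z i) x\<bar> \<partial>M) - 0) < e / 2"
    using LIMSEQ_D[OF step[of i], of "e / 2"] \<open>0 < e\<close> by auto
  have "norm ((\<integral>x. \<bar>X x - E n X x\<bar> \<partial>M) - 0) < e" if "n \<ge> N" for n
    using cond_exp_approx_error[OF X Z[of i], of n] N[OF that] i by simp
  then show "\<exists>N. \<forall>n\<ge>N. norm ((\<integral>x. \<bar>X x - E n X x\<bar> \<partial>M) - 0) < e"
    by blast
qed

lemma L1_convergence_linear:
  assumes [measurable, simp]: "integrable M X" "integrable M Z"
    and "(\<lambda>n. \<integral>x. \<bar>X x - E n X x\<bar> \<partial>M) \<longlonglongrightarrow> 0"
    and "(\<lambda>n. \<integral>x. \<bar>Z x - E n Z x\<bar> \<partial>M) \<longlonglongrightarrow> 0"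
  shows "(\<lambda>n. \<integral>x. \<bar>(X x + c * Z x) - E n (\<lambda>x. X x + c * Z x) x\<bar> \<partial>M) \<longlonglongrightarrow> 0"
proof (rule tendsto_sandwich[OF always_eventually always_eventually, where f="\<lambda>n. 0"
      and h="\<lambda>n. (\<integral>x. \<bar>X x - E n X x\<bar> \<partial>M) + \<bar>c\<bar> * (\<integral>x. \<bar>Z x - E n Z x\<bar> \<partial>M)"])
  have int: "integrable M (E n X)" "integrable M (E n Z)" "integrable M (E n (\<lambda>x. X x + c * Z x))" for n
    by (auto intro!: cond.real_cond_exp_int)
  have 1: "AE x in M. \<bar>(X x + c * Z x) - E n (\<lambda>x. X x + c * Z x) x\<bar> \<le> \<bar>X x - E n X x\<bar> + \<bar>c\<bar> * \<bar>Z x - E n Z x\<bar>" for n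
  proof -
    have "AE x in M. E n (\<lambda>x. X x + c * Z x) x = E n X x + E n (\<lambda>x. c * Z x) x"
      by (rule cond.real_cond_exp_add) auto
    moreover have "AE x in M. E n (\<lambda>x. c * Z x) x = c * E n Z x"
      by (rule cond.real_cond_exp_cmult) auto
    ultimately show ?thesis
    proof eventually_elim
      case (elim x)
      have "(X x + c * Z x) - E n (\<lambda>x. X x + c * Z x) x = (X x - E n X x) + c * (Z x - E n Z x)"
        using elim by (simp add: algebra_simps)
      then show ?case
        by (metis abs_mult abs_triangle_ineq)
    qed
  qed
  have "(\<integral>x. \<bar>(X x + c * Z x) - E n (\<lambda>x. X x + c * Z x) x\<bar> \<partial>M)
      \<le> (\<integral>x. \<bar>X x - E n X x\<bar> + \<bar>c\<bar> * \<bar>Z x - E n Z x\<bar> \<partial>M)" for n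
    using int 1 by (intro integral_mono_AE) auto
  then show "\<forall>n. (\<integral>x. \<bar>(X x + c * Z x) - E n (\<lambda>x. X x + c * Z x) x\<bar> \<partial>M)
      \<le> (\<integral>x. \<bar>X x - E n X x\<bar> \<partial>M) + \<bar>c\<bar> * (\<integral>x. \<bar>Z x - E n Z x\<bar> \<partial>M)"
    using int by simp
  show "(\<lambda>n. (\<integral>x. \<bar>X x - E n X x\<bar> \<partial>M) + \<bar>c\<bar> * (\<integral>x. \<bar>Z x - E n Z x\<bar> \<partial>M)) \<longlonglongrightarrow> 0"
    using tendsto_add[OF assms(3) tendsto_mult_left[OF assms(4), of "\<bar>c\<bar>"]] by simp
qed auto

lemma L1_convergence_of_adapted:
  assumes "integrable M Z" "Z \<in> borel_measurable (F k)"
  shows "(\<lambda>n. \<integral>x. \<bar>Z x - E n Z x\<bar> \<partial>M) \<longlonglongrightarrow> 0"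
proof (rule tendsto_eventually, rule eventually_sequentiallyI[of k])
  fix n assume "k \<le> n"
  have "AE x in M. E n Z x = Z x"
    by (rule cond.real_cond_exp_F_meas[OF assms(1) measurable_F_mono[OF assms(2) \<open>k \<le> n\<close>]])
  then have "AE x in M. \<bar>Z x - E n Z x\<bar> = 0"
    by eventually_elim simp
  then show "(\<integral>x. \<bar>Z x - E n Z x\<bar> \<partial>M) = 0"
    by (rule integral_eq_zero_AE)
qed

text \<open>
  The sets whose indicators are approximated form a Dynkin system: complements and finite disjoint
  unions are linear combinations, and a countable disjoint union is an \<open>L\<^sup>1\<close> limit of finite ones. The
  system contains the algebra of all sets that belong to some \<open>F n\<close>, where the error eventually vanishes. That
  algebra is stable under intersection and generates \<open>M\<close>, so the system exhausts \<open>sets M\<close>.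
\<close>
lemma L1_convergence_indicator:
  assumes "A \<in> sets M"
  shows "(\<lambda>n. \<integral>x. \<bar>indicator A x - E n (indicator A) x\<bar> \<partial>M) \<longlonglongrightarrow> 0"
proof -
  let ?G = "\<Union>n. sets (F n)"
  have sub: "?G \<subseteq> Pow (space M)"
    using sets.sets_into_space space_F by blast
  have int_ind: "integrable M (indicator B :: 'a \<Rightarrow> real)" if "B \<in> sets M" for B
    using that by (simp add: integrable_indicator_iff less_top[symmetric])
  have *: "A \<in> sigma_sets (space M) ?G" using assms sets_F_generate by simp
  have stable: "Int_stable ?G"
  proof (rule Int_stableI, clarify)
    fix a b i j assume "a \<in> sets (F i)" "b \<in> sets (F j)"
    then have "a \<in> sets (F (max i j))" "b \<in> sets (F (max i j))"
      using sets_F_mono[of i "max i j"] sets_F_mono[of j "max i j"] by auto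
    then show "a \<inter> b \<in> (\<Union>n. sets (F n))" by blast
  qed
  from stable sub * show ?thesis
  proof (induction rule: sigma_sets_induct_disjoint)
    case (basic B)
    then obtain k where k: "B \<in> sets (F k)" by auto
    show ?case
    proof (rule L1_convergence_of_adapted[of _ k])
      show "integrable M (indicator B :: 'a \<Rightarrow> real)" using k sets_F_subset by (blast intro: int_ind)
    qed (use k in simp)
  next
    case empty
    then show ?case by (intro L1_convergence_of_adapted[of _ 0]) auto
  next
    case (compl B)
    then have B: "B \<in> sets M" using sets_F_generate by simp
    let ?X = "\<lambda>x. indicator (space M) x + (- 1) * indicator B x :: real"
    have "(\<lambda>n. \<integral>x. \<bar>?X x - E n ?X x\<bar> \<partial>M) \<longlonglongrightarrow> 0"
    proof (rule L1_convergence_linear)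
      show "(\<lambda>n. \<integral>x. \<bar>indicator (space M) x - E n (indicator (space M)) x\<bar> \<partial>M) \<longlonglongrightarrow> 0"
        by (rule L1_convergence_of_adapted[of _ 0]) (auto simp: int_ind sets_F_0 intro!: borel_measurable_indicator)
    qed (use B compl in \<open>auto simp: int_ind\<close>)
    moreover have "indicator (space M - B) = ?X"
      using sets.sets_into_space[OF B] by (auto simp: indicator_def fun_eq_iff)
    ultimately show ?case by (simp only:)
  next
    case (union B)
    have disj: "disjoint_family B" using union by blast
    have B: "B i \<in> sets M" for i using union sets_F_generate by auto
    let ?Z = "\<lambda>i. indicator (\<Union>j<i. B j) :: 'a \<Rightarrow> real"
    show ?case
    proof (rule L1_convergence_closed[where Z="?Z"])
      show "integrable M (indicator (\<Union>i. B i) :: 'a \<Rightarrow> real)" using B by (intro int_ind) auto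
      show "integrable M (?Z i)" for i using B by (intro int_ind) auto
      have "(\<lambda>i. \<integral>x. \<bar>indicator (\<Union>i. B i) x - ?Z i x\<bar> \<partial>M) \<longlonglongrightarrow> (\<integral>x. 0 \<partial>M)"
      proof (rule integral_dominated_convergence[where w="\<lambda>x. 1"])
        show "AE x in M. (\<lambda>i. \<bar>indicator (\<Union>i. B i) x - ?Z i x\<bar>) \<longlonglongrightarrow> 0"
        proof (rule AE_I2)
          fix x
          have "(\<lambda>i. indicator (\<Union>i. B i) x - ?Z i x) \<longlonglongrightarrow> 0"
            using tendsto_diff[OF tendsto_const LIMSEQ_indicator_UN[of B x], of "indicator (\<Union>i. B i) x :: real"]
            by simp
          then show "(\<lambda>i. \<bar>indicator (\<Union>i. B i) x - ?Z i x\<bar>) \<longlonglongrightarrow> 0"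
            by (rule tendsto_rabs_zero)
        qed
        show "AE x in M. norm \<bar>indicator (\<Union>i. B i) x - ?Z i x\<bar> \<le> 1" for i
          by (auto simp: indicator_def)
      qed (use B in measurable)
      then show "(\<lambda>i. \<integral>x. \<bar>indicator (\<Union>i. B i) x - ?Z i x\<bar> \<partial>M) \<longlonglongrightarrow> 0" by simp
    next
      fix i show "(\<lambda>n. \<integral>x. \<bar>?Z i x - E n (?Z i) x\<bar> \<partial>M) \<longlonglongrightarrow> 0"
      proof (induction i)
        case 0
        show ?case by (intro L1_convergence_of_adapted[of _ 0]) auto
      next
        case (Suc i)
        let ?X = "\<lambda>x. ?Z i x + 1 * indicator (B i) x :: real"
        have "(\<lambda>n. \<integral>x. \<bar>?X x - E n ?X x\<bar> \<partial>M) \<longlonglongrightarrow> 0"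
          by (rule L1_convergence_linear) (use B Suc union in \<open>auto intro!: int_ind\<close>)
        moreover have "?Z (Suc i) = ?X"
        proof
          fix x
          have "x \<notin> B j" if "x \<in> B i" "j < i" for j
            using disjoint_family_onD[OF disj, of i j] that by auto
          then show "?Z (Suc i) x = ?X x"
            by (auto simp: indicator_def less_Suc_eq)
        qed
        ultimately show ?case by (simp only:)
      qed
    qed
  qed
qed

text \<open>
  Levy's upward theorem in the mean: indicators are dense up to the linear and \<open>L\<^sup>1\<close>-closed operations
  of the preceding lemmas.
\<close>
theorem L1_martingale_convergence:
  assumes "integrable M X"
  shows "(\<lambda>n. \<integral>x. \<bar>X x - E n X x\<bar> \<partial>M) \<longlonglongrightarrow> 0"
  using assms
proof (induction rule: integrable_induct)
  case (base A c)
  let ?X = "\<lambda>x. 0 + c * indicator A x :: real"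
  have "(\<lambda>n. \<integral>x. \<bar>?X x - E n ?X x\<bar> \<partial>M) \<longlonglongrightarrow> 0"
  proof (rule L1_convergence_linear)
    show "(\<lambda>n. \<integral>x. \<bar>0 - E n (\<lambda>x. 0) x\<bar> \<partial>M) \<longlonglongrightarrow> 0"
      by (rule L1_convergence_of_adapted) auto
  qed (use base L1_convergence_indicator in auto)
  then show ?case by (simp add: mult.commute)
next
  case (add f g)
  then show ?case using L1_convergence_linear[of f g 1] by simp
next
  case (lim f s)
  have "(\<lambda>i. \<integral>x. \<bar>f x - s i x\<bar> \<partial>M) \<longlonglongrightarrow> (\<integral>x. 0 \<partial>M)"
  \<comment> \<open>The induction rule supplies approximants bounded by twice the limit, whence the factor 3.\<close>
  proof (rule integral_dominated_convergence[where w="\<lambda>x. 3 * \<bar>f x\<bar>"])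
    show "AE x in M. (\<lambda>i. \<bar>f x - s i x\<bar>) \<longlonglongrightarrow> 0"
    proof (rule AE_I2)
      fix x assume "x \<in> space M"
      then have "(\<lambda>i. f x - s i x) \<longlonglongrightarrow> 0"
        using tendsto_diff[OF tendsto_const lim.hyps(2), of x "f x"] by simp
      then show "(\<lambda>i. \<bar>f x - s i x\<bar>) \<longlonglongrightarrow> 0" by (rule tendsto_rabs_zero)
    qed
    show "AE x in M. norm \<bar>f x - s i x\<bar> \<le> 3 * \<bar>f x\<bar>" for i
      by (rule AE_I2) (use lim.hyps(3)[of _ i] in fastforce)
  qed (use lim in auto)
  then show ?case using lim by (intro L1_convergence_closed[of f s]) auto
qed

end

section \<open>Conditional variance and the extended conditional expectation\<close>

lemma ennreal_sqrt_squared: "(ennreal_sqrt t)\<^sup>2 = t"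
proof (cases t)
  case (real r)
  then show ?thesis
    by (simp add: ennreal_sqrt_def ennreal_power)
qed (simp add: ennreal_sqrt_def power2_eq_square ennreal_top_mult)

context filtered_prob_space
begin

text \<open>
  The square function is built from the extended nonnegative conditional expectation, while the
  estimates are made for the real one; both have the same integrals over the sets of \<open>F n\<close>.
\<close>
lemma nn_cond_exp_eq_cond_exp:
  assumes X [measurable, simp]: "integrable M X" and nonneg: "\<And>x. 0 \<le> X x"
  shows "AE x in M. nn_cond_exp M (F n) (\<lambda>x. ennreal (X x)) x = ennreal (E n X x)"
proof -
  have pos: "AE x in M. 0 \<le> E n X x"
    by (rule cond.real_cond_exp_pos) (use nonneg in auto)
  have "AE x in M. ennreal (E n X x) = nn_cond_exp M (F n) (\<lambda>x. ennreal (X x)) x"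
  proof (rule cond.nn_cond_exp_charact)
    fix A assume A: "A \<in> sets (F n)"
    then have [measurable]: "A \<in> sets M" using sets_F_subset by blast
    have 1: "integrable M (\<lambda>x. indicator A x * X x)"
      using integrable_mult_indicator[of A M X] by simp
    have 2: "integrable M (\<lambda>x. indicator A x * E n X x)"
      using integrable_mult_indicator[of A M "E n X"] by (simp add: cond.real_cond_exp_int)
    have "(\<integral>\<^sup>+x\<in>A. ennreal (X x) \<partial>M) = (\<integral>\<^sup>+x. ennreal (indicator A x * X x) \<partial>M)"
      by (intro nn_integral_cong) (auto simp: indicator_def)
    also have "\<dots> = ennreal (\<integral>x. indicator A x * X x \<partial>M)"
      by (rule nn_integral_eq_integral[OF 1]) (use nonneg in auto)
    also have "(\<integral>x. indicator A x * X x \<partial>M) = (\<integral>x. indicator A x * E n X x \<partial>M)"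
      by (rule cond.real_cond_exp_intg(2)[symmetric]) (use 1 A in auto)
    also have "ennreal \<dots> = (\<integral>\<^sup>+x. ennreal (indicator A x * E n X x) \<partial>M)"
      by (rule nn_integral_eq_integral[OF 2, symmetric]) (use pos in \<open>auto elim!: eventually_mono\<close>)
    also have "\<dots> = (\<integral>\<^sup>+x\<in>A. ennreal (E n X x) \<partial>M)"
      by (intro nn_integral_cong) (auto simp: indicator_def)
    finally show "(\<integral>\<^sup>+x\<in>A. ennreal (X x) \<partial>M) = (\<integral>\<^sup>+x\<in>A. ennreal (E n X x) \<partial>M)" .
  qed auto
  then show ?thesis by eventually_elim simp
qed

lemma cond_exp_unit_interval:
  assumes "X \<in> borel_measurable M" "AE x in M. 0 \<le> X x \<and> X x \<le> 1"
  shows "AE x in M. 0 \<le> E n X x \<and> E n X x \<le> 1"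
  using cond.real_cond_exp_ge_c[OF integrable_unit_interval[OF assms], of 0]
    cond.real_cond_exp_le_c[OF integrable_unit_interval[OF assms], of 1] assms(2)
  by auto

lemma cond_variance:
  assumes X [measurable]: "X \<in> borel_measurable M" and bnd: "AE x in M. 0 \<le> X x \<and> X x \<le> 1"
  shows "AE x in M. E n (\<lambda>y. (X y - E n X y)\<^sup>2) x = E n (\<lambda>y. (X y)\<^sup>2) x - (E n X x)\<^sup>2"
proof -
  let ?\<mu> = "E n X"
  note \<mu> = cond_exp_unit_interval[OF X bnd, of n]
  have [simp]: "integrable M (\<lambda>x. (X x)\<^sup>2)"
    by (rule integrable_unit_interval) (use bnd in \<open>auto simp: power_le_one\<close>)
  have [simp]: "integrable M (\<lambda>x. (?\<mu> x)\<^sup>2)"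
    by (rule integrable_unit_interval) (use \<mu> in \<open>auto simp: power_le_one\<close>)
  have [simp]: "integrable M (\<lambda>x. ?\<mu> x * X x)"
  proof (rule integrable_unit_interval)
    show "AE x in M. 0 \<le> ?\<mu> x * X x \<and> ?\<mu> x * X x \<le> 1"
      using \<mu> bnd by eventually_elim (auto intro: mult_le_one)
  qed auto
  have expand: "(\<lambda>y. (X y - ?\<mu> y)\<^sup>2) = (\<lambda>y. ((X y)\<^sup>2 - 2 * (?\<mu> y * X y)) + (?\<mu> y)\<^sup>2)"
    by (auto simp: power2_eq_square algebra_simps)
  have "AE x in M. E n (\<lambda>y. (X y - ?\<mu> y)\<^sup>2) x = E n (\<lambda>y. (X y)\<^sup>2 - 2 * (?\<mu> y * X y)) x + E n (\<lambda>y. (?\<mu> y)\<^sup>2) x"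
    unfolding expand by (rule cond.real_cond_exp_add) auto
  moreover have "AE x in M. E n (\<lambda>y. (X y)\<^sup>2 - 2 * (?\<mu> y * X y)) x = E n (\<lambda>y. (X y)\<^sup>2) x - E n (\<lambda>y. 2 * (?\<mu> y * X y)) x"
    by (rule cond.real_cond_exp_diff) auto
  moreover have "AE x in M. E n (\<lambda>y. 2 * (?\<mu> y * X y)) x = 2 * E n (\<lambda>y. ?\<mu> y * X y) x"
    by (rule cond.real_cond_exp_cmult) auto
  moreover have "AE x in M. E n (\<lambda>y. ?\<mu> y * X y) x = ?\<mu> x * E n X x"
    by (rule cond.real_cond_exp_mult) auto
  moreover have "AE x in M. E n (\<lambda>y. (?\<mu> y)\<^sup>2) x = (?\<mu> x)\<^sup>2"
    by (rule cond.real_cond_exp_F_meas) auto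
  ultimately show ?thesis
    by eventually_elim (simp add: power2_eq_square)
qed

end

section \<open>Quasi-arithmetic conditional means\<close>

locale bounded_target = filtered_prob_space M F
  for M :: "'a measure" and F +
  fixes f :: "'a \<Rightarrow> real"
  assumes f_measurable [measurable]: "f \<in> borel_measurable M"
    and f_bounds: "\<And>x. x \<in> space M \<Longrightarrow> 0 \<le> f x \<and> f x \<le> 1"
begin

lemma f_AE_bounds: "AE x in M. 0 \<le> f x \<and> f x \<le> 1"
  by (rule AE_I2) (rule f_bounds)

text \<open>
  A concave function with three competing virtues: it is strongly concave, so that the Jensen gap
  controls a variance; its slope is at least 1/2 on the unit interval, so that it is invertible there with a
  Lipschitz inverse; and it stays above \<open>exp (- a) * t\<close> for \<open>0 \<le> t \<le> a \<le> 1\<close>. Among such functions it is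
  convenient because \<open>1 - \<phi> t\<close> is a square.
\<close>
definition \<phi> :: "real \<Rightarrow> real"
  where "\<phi> t = t - t\<^sup>2 / 4"

text \<open>
  This is \<open>\<phi>\<^sup>-\<^sup>1 (E n (\<phi> \<circ> f))\<close>, the quasi-arithmetic conditional mean of \<open>f\<close> generated by \<open>\<phi>\<close>.
\<close>
definition quasi_mean :: "nat \<Rightarrow> 'a \<Rightarrow> real"
  where "quasi_mean n x = 2 * (1 - sqrt (1 - E n (\<lambda>y. \<phi> (f y)) x))"

definition \<mu> :: "nat \<Rightarrow> 'a \<Rightarrow> real"
  where "\<mu> n = E n (quasi_mean (Suc n))"

lemma one_minus_phi: "1 - \<phi> t = (1 - t / 2)\<^sup>2"
  by (simp add: \<phi>_def power2_eq_square field_simps)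

lemma \<phi>_f_bounds: "AE x in M. 0 \<le> \<phi> (f x) \<and> \<phi> (f x) \<le> 3/4"
proof (rule AE_I2)
  fix x assume "x \<in> space M"
  then have x: "0 \<le> f x" "f x \<le> 1" using f_bounds by auto
  then have "(1/2)\<^sup>2 \<le> (1 - f x / 2)\<^sup>2" "(1 - f x / 2)\<^sup>2 \<le> 1"
    by (auto intro!: power_mono power_le_one)
  then show "0 \<le> \<phi> (f x) \<and> \<phi> (f x) \<le> 3/4"
    using one_minus_phi[of "f x"] by (simp add: power2_eq_square)
qed

lemma \<phi>_f_measurable [measurable]: "(\<lambda>x. \<phi> (f x)) \<in> borel_measurable M"
  unfolding \<phi>_def by measurable

lemma \<phi>_f_integrable [simp]: "integrable M (\<lambda>x. \<phi> (f x))"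
  by (rule integrable_unit_interval) (use \<phi>_f_bounds in auto)

lemma quasi_mean_measurable [measurable]: "quasi_mean n \<in> borel_measurable (F n)"
  unfolding quasi_mean_def by measurable

lemma quasi_mean_measurable_M [measurable]: "quasi_mean n \<in> borel_measurable M"
  by (rule measurable_F_M[OF quasi_mean_measurable])

lemma quasi_mean_props:
  "AE x in M. 0 \<le> quasi_mean n x \<and> quasi_mean n x \<le> 1 \<and> \<phi> (quasi_mean n x) = E n (\<lambda>y. \<phi> (f y)) x"
proof -
  have "AE x in M. 0 \<le> E n (\<lambda>y. \<phi> (f y)) x" "AE x in M. E n (\<lambda>y. \<phi> (f y)) x \<le> 3/4"
  proof -
    have bnd: "AE x in M. 0 \<le> \<phi> (f x)" "AE x in M. \<phi> (f x) \<le> 3/4"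
      using \<phi>_f_bounds by (eventually_elim, simp)+
    show "AE x in M. 0 \<le> E n (\<lambda>y. \<phi> (f y)) x"
      by (rule cond.real_cond_exp_ge_c[OF \<phi>_f_integrable bnd(1)])
    show "AE x in M. E n (\<lambda>y. \<phi> (f y)) x \<le> 3/4"
      by (rule cond.real_cond_exp_le_c[OF \<phi>_f_integrable bnd(2)])
  qed
  then show ?thesis
  proof eventually_elim
    case (elim x)
    let ?s = "sqrt (1 - E n (\<lambda>y. \<phi> (f y)) x)"
    have "sqrt ((1/2)\<^sup>2) \<le> ?s" "?s \<le> sqrt 1" "?s\<^sup>2 = 1 - E n (\<lambda>y. \<phi> (f y)) x"
      using elim by (auto intro!: real_sqrt_le_mono simp: power2_eq_square)
    moreover have "1 - \<phi> (quasi_mean n x) = ?s\<^sup>2"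
      unfolding one_minus_phi by (simp add: quasi_mean_def diff_divide_distrib)
    ultimately show ?case
      by (auto simp: quasi_mean_def)
  qed
qed

lemma quasi_mean_bounds: "AE x in M. 0 \<le> quasi_mean n x \<and> quasi_mean n x \<le> 1"
  using quasi_mean_props[of n] by eventually_elim simp

lemma quasi_mean_integrable [simp]: "integrable M (quasi_mean n)"
  by (rule integrable_unit_interval) (use quasi_mean_bounds in auto)

text \<open>
  Since \<open>\<phi>\<close> has slope at least 1/2 on the unit interval, the distance of the quasi-means from \<open>f\<close> is at
  most twice that of the martingale \<open>E n (\<phi> \<circ> f)\<close> from its limit \<open>\<phi> \<circ> f\<close>.
\<close>
lemma quasi_mean_tendsto_f: "(\<lambda>n. \<integral>x. \<bar>quasi_mean n x - f x\<bar> \<partial>M) \<longlonglongrightarrow> 0"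
proof (rule tendsto_sandwich[OF always_eventually always_eventually, where f="\<lambda>n. 0"
      and h="\<lambda>n. 2 * (\<integral>x. \<bar>\<phi> (f x) - E n (\<lambda>y. \<phi> (f y)) x\<bar> \<partial>M)"])
  have int: "integrable M (E n (\<lambda>y. \<phi> (f y)))" for n
    by (auto intro!: cond.real_cond_exp_int)
  have f: "integrable M f"
    by (rule integrable_unit_interval) (use f_bounds in auto)
  have "AE x in M. \<bar>quasi_mean n x - f x\<bar> \<le> 2 * \<bar>\<phi> (f x) - E n (\<lambda>y. \<phi> (f y)) x\<bar>" for n
    using quasi_mean_props[of n] f_AE_bounds
  proof eventually_elim
    case (elim x)
    have "\<phi> (f x) - E n (\<lambda>y. \<phi> (f y)) x = (f x - quasi_mean n x) * (1 - (f x + quasi_mean n x) / 4)"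
      using elim by (auto simp: \<phi>_def power2_eq_square field_simps)
    moreover have "1/2 \<le> \<bar>1 - (f x + quasi_mean n x) / 4\<bar>" using elim by auto
    ultimately have "\<bar>f x - quasi_mean n x\<bar> * (1/2) \<le> \<bar>\<phi> (f x) - E n (\<lambda>y. \<phi> (f y)) x\<bar>"
      by (simp only: abs_mult mult_left_mono abs_ge_zero)
    then show ?case by auto
  qed
  then have "(\<integral>x. \<bar>quasi_mean n x - f x\<bar> \<partial>M) \<le> (\<integral>x. 2 * \<bar>\<phi> (f x) - E n (\<lambda>y. \<phi> (f y)) x\<bar> \<partial>M)" for n
    using int f by (intro integral_mono_AE) auto
  then show "\<forall>n. (\<integral>x. \<bar>quasi_mean n x - f x\<bar> \<partial>M) \<le> 2 * (\<integral>x. \<bar>\<phi> (f x) - E n (\<lambda>y. \<phi> (f y)) x\<bar> \<partial>M)"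
    by simp
  show "(\<lambda>n. 2 * (\<integral>x. \<bar>\<phi> (f x) - E n (\<lambda>y. \<phi> (f y)) x\<bar> \<partial>M)) \<longlonglongrightarrow> 0"
    using tendsto_mult_left[OF L1_martingale_convergence[OF \<phi>_f_integrable], of 2] by simp
qed auto

lemma \<mu>_measurable [measurable]: "\<mu> n \<in> borel_measurable (F n)"
  unfolding \<mu>_def by measurable

lemma \<mu>_measurable_M [measurable]: "\<mu> n \<in> borel_measurable M"
  by (rule measurable_F_M[OF \<mu>_measurable])

text \<open>
  The heart of the argument. Put \<open>X = quasi_mean (Suc n)\<close>. Both \<open>\<phi> X\<close> and \<open>\<phi> (quasi_mean n)\<close> are terms of
  the martingale \<open>E n (\<phi> \<circ> f)\<close>, so \<open>\<mu> n - E n X\<^sup>2 / 4 = quasi_mean n - (quasi_mean n)\<^sup>2 / 4\<close>. Jensen's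
  inequality \<open>(\<mu> n)\<^sup>2 \<le> E n X\<^sup>2\<close> and the monotonicity of \<open>\<phi>\<close> give \<open>quasi_mean n \<le> \<mu> n\<close>; then the same
  identity reads \<open>4 * (\<mu> n - quasi_mean n) = E n X\<^sup>2 - (quasi_mean n)\<^sup>2\<close>, which is at least the conditional
  variance \<open>E n X\<^sup>2 - (\<mu> n)\<^sup>2\<close>.
\<close>
lemma cond_variance_le_jensen_gap:
  "AE x in M. E n (\<lambda>y. (quasi_mean (Suc n) y - \<mu> n y)\<^sup>2) x \<le> 4 * (\<mu> n x - quasi_mean n x) \<and>
    0 \<le> quasi_mean n x \<and> quasi_mean n x \<le> \<mu> n x \<and> \<mu> n x \<le> 1"
proof -
  let ?X = "quasi_mean (Suc n)" and ?p = "\<lambda>y. \<phi> (f y)"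
  have [simp]: "integrable M (\<lambda>x. (?X x)\<^sup>2)"
    by (rule integrable_unit_interval) (use quasi_mean_bounds[of "Suc n"] in \<open>auto simp: power_le_one\<close>)
  have var: "AE x in M. E n (\<lambda>y. (?X y - \<mu> n y)\<^sup>2) x = E n (\<lambda>y. (?X y)\<^sup>2) x - (\<mu> n x)\<^sup>2"
    unfolding \<mu>_def by (rule cond_variance[OF _ quasi_mean_bounds]) measurable
  have \<mu>_bounds: "AE x in M. 0 \<le> \<mu> n x \<and> \<mu> n x \<le> 1"
    unfolding \<mu>_def by (rule cond_exp_unit_interval[OF _ quasi_mean_bounds]) measurable
  have pos: "AE x in M. 0 \<le> E n (\<lambda>y. (?X y - \<mu> n y)\<^sup>2) x"
    by (rule cond.real_cond_exp_pos) auto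
  have "AE x in M. E n (\<lambda>y. ?X y - 1/4 * (?X y)\<^sup>2) x = \<mu> n x - E n (\<lambda>y. 1/4 * (?X y)\<^sup>2) x"
    unfolding \<mu>_def by (rule cond.real_cond_exp_diff) auto
  moreover have "AE x in M. E n (\<lambda>y. 1/4 * (?X y)\<^sup>2) x = 1/4 * E n (\<lambda>y. (?X y)\<^sup>2) x"
    by (rule cond.real_cond_exp_cmult) auto
  moreover have "AE x in M. E n (\<lambda>y. ?X y - 1/4 * (?X y)\<^sup>2) x = E n (E (Suc n) ?p) x"
    by (rule cond.real_cond_exp_cong)
      (use quasi_mean_props[of "Suc n"] in \<open>auto simp: \<phi>_def elim!: eventually_mono\<close>)
  moreover have "AE x in M. E n (E (Suc n) ?p) x = E n ?p x"
    by (rule cond.real_cond_exp_nested_subalg)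
      (auto simp: subalgebra_def space_F sets_F_subset sets_F_mono)
  ultimately show ?thesis
    using var pos quasi_mean_props[of n] \<mu>_bounds
  proof eventually_elim
    case (elim x)
    have \<phi>: "\<mu> n x - E n (\<lambda>y. (?X y)\<^sup>2) x / 4 = quasi_mean n x - (quasi_mean n x)\<^sup>2 / 4"
      using elim unfolding \<phi>_def by simp
    have jensen: "(\<mu> n x)\<^sup>2 \<le> E n (\<lambda>y. (?X y)\<^sup>2) x"
      using elim by linarith
    have le: "quasi_mean n x \<le> \<mu> n x"
    proof (rule ccontr)
      assume "\<not> quasi_mean n x \<le> \<mu> n x"
      then have "0 < (quasi_mean n x - \<mu> n x) * (1 - (quasi_mean n x + \<mu> n x) / 4)"
        using elim by (intro mult_pos_pos) auto
      also have "\<dots> = (quasi_mean n x - (quasi_mean n x)\<^sup>2 / 4) - (\<mu> n x - (\<mu> n x)\<^sup>2 / 4)"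
        by (simp add: power2_eq_square field_simps)
      finally show False
        using jensen \<phi> by linarith
    qed
    then have "(quasi_mean n x)\<^sup>2 \<le> (\<mu> n x)\<^sup>2" using elim by (intro power_mono) auto
    then have "E n (\<lambda>y. (?X y)\<^sup>2) x - (\<mu> n x)\<^sup>2 \<le> 4 * (\<mu> n x - quasi_mean n x)"
      using \<phi> by (simp add: field_simps)
    then show ?case using elim le by simp
  qed
qed

section \<open>The predictable weights and the multiplier\<close>

text \<open>
  The factor that turns the submartingale \<open>quasi_mean\<close> into a martingale. The first branch holds
  almost everywhere; there, where \<open>\<mu> n\<close> vanishes, so does \<open>quasi_mean n\<close>, and the convention \<open>0 / 0 = 0\<close>
  preserves \<open>ratio n * \<mu> n = quasi_mean n\<close>.
  The default 1 keeps the factor in the unit interval at every point.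
\<close>
definition ratio :: "nat \<Rightarrow> 'a \<Rightarrow> real"
  where "ratio n x = (if 0 \<le> quasi_mean n x \<and> quasi_mean n x \<le> \<mu> n x then quasi_mean n x / \<mu> n x else 1)"

definition weight :: "nat \<Rightarrow> 'a \<Rightarrow> real"
  where "weight n x = (\<Prod>i<n. ratio i x)"

definition multiplier :: "'a \<Rightarrow> real"
  where "multiplier x = lim (\<lambda>n. weight n x)"

lemma ratio_bounds: "0 \<le> ratio n x" "ratio n x \<le> 1"
  by (auto simp: ratio_def divide_le_eq_1)

lemma ratio_measurable: "ratio n \<in> borel_measurable (F n)"
  unfolding ratio_def by measurable

lemma weight_Suc: "weight (Suc n) x = weight n x * ratio n x"
  by (simp add: weight_def mult.commute)

lemma weight_bounds: "0 \<le> weight n x" "weight n x \<le> 1"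
  by (auto simp: weight_def ratio_bounds intro: prod_nonneg prod_le_1)

lemma weight_decseq: "decseq (\<lambda>n. weight n x)"
  by (rule decseq_SucI) (simp add: weight_Suc mult_left_le ratio_bounds weight_bounds)

text \<open>
  Predictability allows the weight to be pulled out of the conditional expectation one step earlier,
  both for the martingale property and for the conditional square of the increment.
\<close>
lemma weight_predictable: "weight (Suc n) \<in> borel_measurable (F n)"
  unfolding weight_def using measurable_F_mono[OF ratio_measurable]
  by (intro borel_measurable_prod) auto

lemma weight_adapted: "weight n \<in> borel_measurable (F n)"
  unfolding weight_def using measurable_F_mono[OF ratio_measurable]
  by (intro borel_measurable_prod) auto

lemma weight_measurable [measurable]: "weight n \<in> borel_measurable M"
  by (rule measurable_F_M[OF weight_adapted])

lemma weight_tendsto_multiplier: "(\<lambda>n. weight n x) \<longlonglongrightarrow> multiplier x"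
  unfolding multiplier_def
  by (metis weight_decseq weight_bounds(1) decseq_convergent convergent_LIMSEQ_iff convergentI)

lemma multiplier_bounds: "0 \<le> multiplier x" "multiplier x \<le> 1"
  using weight_tendsto_multiplier[of x] weight_bounds by (auto intro: LIMSEQ_le_const LIMSEQ_le_const2)

lemma multiplier_measurable [measurable]: "multiplier \<in> borel_measurable M"
  by (rule borel_measurable_LIMSEQ_real[OF weight_tendsto_multiplier]) auto

lemma weight_balance: "AE x in M. weight (Suc n) x * \<mu> n x = weight n x * quasi_mean n x"
  using cond_variance_le_jensen_gap[of n] by eventually_elim (auto simp: weight_Suc ratio_def)

lemma martingale_bounds: "AE x in M. 0 \<le> weight n x * quasi_mean n x \<and> weight n x * quasi_mean n x \<le> 1"
  using quasi_mean_bounds[of n] by eventually_elim (auto simp: weight_bounds intro: mult_le_one)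

lemma martingale_integrable [simp]: "integrable M (\<lambda>x. weight n x * quasi_mean n x)"
  by (rule integrable_unit_interval) (use martingale_bounds in auto)

lemma martingale_step: "AE x in M. E n (\<lambda>x. weight (Suc n) x * quasi_mean (Suc n) x) x = weight n x * quasi_mean n x"
proof -
  have "AE x in M. E n (\<lambda>x. weight (Suc n) x * quasi_mean (Suc n) x) x = weight (Suc n) x * E n (quasi_mean (Suc n)) x"
    by (rule cond.real_cond_exp_mult[OF weight_predictable]) auto
  then show ?thesis
    using weight_balance[of n] by eventually_elim (simp add: \<mu>_def)
qed

lemma martingale: "k \<le> n \<Longrightarrow> AE x in M. E k (\<lambda>x. weight n x * quasi_mean n x) x = weight k x * quasi_mean k x"
proof (induction n rule: dec_induct)
  case base
  show ?case
    by (rule cond.real_cond_exp_F_meas) (auto intro!: borel_measurable_times weight_adapted)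
next
  case (step n)
  have "AE x in M. E k (E n (\<lambda>x. weight (Suc n) x * quasi_mean (Suc n) x)) x = E k (\<lambda>x. weight (Suc n) x * quasi_mean (Suc n) x) x"
    using step by (intro cond.real_cond_exp_nested_subalg)
      (auto simp: subalgebra_def space_F sets_F_subset sets_F_mono)
  moreover have "AE x in M. E k (E n (\<lambda>x. weight (Suc n) x * quasi_mean (Suc n) x)) x = E k (\<lambda>x. weight n x * quasi_mean n x) x"
    by (rule cond.real_cond_exp_cong[OF martingale_step]) auto
  ultimately show ?case
    using step.IH by eventually_elim simp
qed

lemma product_integrable [simp]: "integrable M (\<lambda>x. multiplier x * f x)"
  by (rule integrable_unit_interval) (auto simp: multiplier_bounds f_bounds intro!: mult_le_one)

lemma martingale_tendsto_product: "(\<lambda>n. \<integral>x. \<bar>multiplier x * f x - weight n x * quasi_mean n x\<bar> \<partial>M) \<longlonglongrightarrow> 0"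
proof (rule tendsto_sandwich[OF always_eventually always_eventually, where f="\<lambda>n. 0"
      and h="\<lambda>n. (\<integral>x. \<bar>weight n x - multiplier x\<bar> \<partial>M) + (\<integral>x. \<bar>quasi_mean n x - f x\<bar> \<partial>M)"])
  have [simp]: "integrable M f"
    by (rule integrable_unit_interval) (use f_bounds in auto)
  have [simp]: "integrable M multiplier" "integrable M (weight n)" for n
    by (auto intro!: integrable_unit_interval simp: multiplier_bounds weight_bounds)
  have "\<bar>multiplier x * f x - weight n x * quasi_mean n x\<bar> \<le> \<bar>weight n x - multiplier x\<bar> + \<bar>quasi_mean n x - f x\<bar>" if "x \<in> space M" for n x
  proof -
    have "\<bar>multiplier x * f x - weight n x * quasi_mean n x\<bar> = \<bar>f x * (multiplier x - weight n x) + weight n x * (f x - quasi_mean n x)\<bar>"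
      by (simp add: algebra_simps)
    also have "\<dots> \<le> \<bar>f x\<bar> * \<bar>multiplier x - weight n x\<bar> + \<bar>weight n x\<bar> * \<bar>f x - quasi_mean n x\<bar>"
      by (metis abs_mult abs_triangle_ineq)
    also have "\<dots> \<le> 1 * \<bar>multiplier x - weight n x\<bar> + 1 * \<bar>f x - quasi_mean n x\<bar>"
      using f_bounds[OF that] by (intro add_mono mult_right_mono) (auto simp: weight_bounds)
    finally show ?thesis by simp
  qed
  then have "(\<integral>x. \<bar>multiplier x * f x - weight n x * quasi_mean n x\<bar> \<partial>M) \<le> (\<integral>x. \<bar>weight n x - multiplier x\<bar> + \<bar>quasi_mean n x - f x\<bar> \<partial>M)" for n
    by (intro integral_mono) auto
  then show "\<forall>n. (\<integral>x. \<bar>multiplier x * f x - weight n x * quasi_mean n x\<bar> \<partial>M)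
      \<le> (\<integral>x. \<bar>weight n x - multiplier x\<bar> \<partial>M) + (\<integral>x. \<bar>quasi_mean n x - f x\<bar> \<partial>M)"
    by simp
  have "(\<lambda>n. \<integral>x. \<bar>weight n x - multiplier x\<bar> \<partial>M) \<longlonglongrightarrow> (\<integral>x. 0 \<partial>M)"
  proof (rule integral_dominated_convergence[where w="\<lambda>x. 1"])
    show "AE x in M. (\<lambda>n. \<bar>weight n x - multiplier x\<bar>) \<longlonglongrightarrow> 0"
      using weight_tendsto_multiplier by (auto intro!: AE_I2 tendsto_rabs_zero LIM_zero)
    have "norm \<bar>weight n x - multiplier x\<bar> \<le> 1" for n x
      using weight_bounds[of n x] multiplier_bounds[of x] by auto
    then show "AE x in M. norm \<bar>weight n x - multiplier x\<bar> \<le> 1" for n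
      by simp
  qed auto
  then show "(\<lambda>n. (\<integral>x. \<bar>weight n x - multiplier x\<bar> \<partial>M) + (\<integral>x. \<bar>quasi_mean n x - f x\<bar> \<partial>M)) \<longlonglongrightarrow> 0"
    using tendsto_add[OF _ quasi_mean_tendsto_f] by force
qed auto

text \<open>
  The martingale \<open>weight k * quasi_mean k\<close> converges in the mean to \<open>multiplier * f\<close>, so it is closed by this
  limit: the \<open>L\<^sup>1\<close> distance of its \<open>k\<close>-th term from the projection of the limit is bounded by quantities
  that tend to 0.
\<close>
lemma cond_exp_product: "AE x in M. E k (\<lambda>x. multiplier x * f x) x = weight k x * quasi_mean k x"
proof -
  let ?I = "\<integral>x. \<bar>E k (\<lambda>x. multiplier x * f x) x - weight k x * quasi_mean k x\<bar> \<partial>M"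
  have [simp]: "integrable M (E k (\<lambda>x. multiplier x * f x))"
    by (auto intro!: cond.real_cond_exp_int)
  have "?I \<le> (\<integral>x. \<bar>multiplier x * f x - weight n x * quasi_mean n x\<bar> \<partial>M)" if "k \<le> n" for n
  proof -
    have "AE x in M. E k (\<lambda>x. multiplier x * f x - weight n x * quasi_mean n x) x
        = E k (\<lambda>x. multiplier x * f x) x - E k (\<lambda>x. weight n x * quasi_mean n x) x"
      by (rule cond.real_cond_exp_diff) auto
    then have "AE x in M. \<bar>E k (\<lambda>x. multiplier x * f x) x - weight k x * quasi_mean k x\<bar>
        = \<bar>E k (\<lambda>x. multiplier x * f x - weight n x * quasi_mean n x) x\<bar>"
      using martingale[OF that] by eventually_elim simp
    then have "?I = (\<integral>x. \<bar>E k (\<lambda>x. multiplier x * f x - weight n x * quasi_mean n x) x\<bar> \<partial>M)"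
      by (intro integral_cong_AE) auto
    then show ?thesis
      using cond_exp_L1_contraction[of "\<lambda>x. multiplier x * f x - weight n x * quasi_mean n x" k] by simp
  qed
  then have "?I \<le> 0"
    by (intro LIMSEQ_le_const[OF martingale_tendsto_product]) auto
  then have "?I = 0" by (intro antisym) auto
  then have "AE x in M. \<bar>E k (\<lambda>x. multiplier x * f x) x - weight k x * quasi_mean k x\<bar> = 0"
    by (subst (asm) integral_nonneg_eq_0_iff_AE) auto
  then show ?thesis by eventually_elim simp
qed

section \<open>The square function\<close>

text \<open>
  The increment of the martingale is the predictable factor \<open>weight (Suc k)\<close> times the centred quasi-mean.
  The variance bound costs \<open>4 * (\<mu> k - quasi_mean k)\<close>, and the balance
  \<open>weight (Suc k) * \<mu> k = weight k * quasi_mean k\<close> converts this cost, weighted by \<open>(weight (Suc k))\<^sup>2\<close>, into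
  the loss of weight \<open>weight k - weight (Suc k)\<close>.
\<close>
lemma square_function_increment:
  "AE x in M. nn_cond_exp M (F k) (\<lambda>y. ennreal (\<bar>mart_diff M F (Suc k) (\<lambda>y. multiplier y * f y) y\<bar>\<^sup>2)) x
    \<le> ennreal (4 * (weight k x - weight (Suc k) x))"
proof -
  let ?g = "\<lambda>y. multiplier y * f y"
  let ?D = "\<lambda>y. quasi_mean (Suc k) y - \<mu> k y"
  let ?V = "\<lambda>y. (weight (Suc k) y)\<^sup>2 * (?D y)\<^sup>2"
  have [measurable]: "mart_diff M F (Suc k) ?g \<in> borel_measurable M"
    unfolding mart_diff_def by measurable
  have D: "AE x in M. \<bar>?D x\<bar> \<le> 1"
    using quasi_mean_bounds[of "Suc k"] cond_variance_le_jensen_gap[of k] by eventually_elim auto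
  have D2: "AE x in M. (?D x)\<^sup>2 \<le> 1"
    using D by eventually_elim (simp add: abs_square_le_1)
  have V: "integrable M ?V"
  proof (rule integrable_unit_interval)
    show "AE x in M. 0 \<le> ?V x \<and> ?V x \<le> 1"
      using D2 by eventually_elim (auto intro!: mult_le_one simp: weight_bounds power_le_one)
  qed auto
  have "AE x in M. mart_diff M F (Suc k) ?g x = weight (Suc k) x * ?D x"
    using cond_exp_product[of "Suc k"] cond_exp_product[of k] weight_balance[of k]
    by eventually_elim (simp add: mart_diff_def algebra_simps)
  then have "AE x in M. ennreal (\<bar>mart_diff M F (Suc k) ?g x\<bar>\<^sup>2) = ennreal (?V x)"
    by eventually_elim (simp add: power_mult_distrib)
  then have "AE x in M. nn_cond_exp M (F k) (\<lambda>y. ennreal (\<bar>mart_diff M F (Suc k) ?g y\<bar>\<^sup>2)) x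
      = nn_cond_exp M (F k) (\<lambda>y. ennreal (?V y)) x"
    by (rule cond.nn_cond_exp_cong) auto
  moreover have "AE x in M. nn_cond_exp M (F k) (\<lambda>y. ennreal (?V y)) x = ennreal (E k ?V x)"
    by (rule nn_cond_exp_eq_cond_exp[OF V]) auto
  moreover have "AE x in M. E k ?V x = (weight (Suc k) x)\<^sup>2 * E k (\<lambda>y. (?D y)\<^sup>2) x"
    by (rule cond.real_cond_exp_mult[OF _ _ V]) (use weight_predictable in auto)
  ultimately show ?thesis
    using cond_variance_le_jensen_gap[of k] weight_balance[of k]
  proof eventually_elim
    case (elim x)
    have "(weight (Suc k) x)\<^sup>2 * E k (\<lambda>y. (?D y)\<^sup>2) x \<le> (weight (Suc k) x)\<^sup>2 * (4 * (\<mu> k x - quasi_mean k x))"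
      using elim by (intro mult_left_mono) auto
    also have "\<dots> = 4 * (weight (Suc k) x * (weight (Suc k) x * \<mu> k x - weight (Suc k) x * quasi_mean k x))"
      by (simp add: power2_eq_square algebra_simps)
    also have "\<dots> = 4 * ((weight (Suc k) x * quasi_mean k x) * (weight k x - weight (Suc k) x))"
      using elim by (simp add: algebra_simps)
    also have "\<dots> \<le> 4 * (1 * (weight k x - weight (Suc k) x))"
      using elim weight_bounds[of "Suc k" x] decseq_SucD[OF weight_decseq[of x], of k]
      by (intro mult_left_mono mult_right_mono mult_le_one) auto
    finally show ?case using elim by (simp add: ennreal_leI)
  qed
qed

text \<open>
  The losses of weight telescope, and the total weight to be lost is 1.
\<close>
lemma square_function_bound: "AE x in M. (cond_square_fun M F (\<lambda>y. multiplier y * f y) x)\<^sup>2 \<le> 4"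
proof -
  have "AE x in M. \<forall>k. nn_cond_exp M (F k) (\<lambda>y. ennreal (\<bar>mart_diff M F (Suc k) (\<lambda>y. multiplier y * f y) y\<bar>\<^sup>2)) x
    \<le> ennreal (4 * (weight k x - weight (Suc k) x))"
    using square_function_increment by (simp add: AE_all_countable)
  then show ?thesis
  proof eventually_elim
    case (elim x)
    have "(\<Sum>k. nn_cond_exp M (F k) (\<lambda>y. ennreal (\<bar>mart_diff M F (Suc k) (\<lambda>y. multiplier y * f y) y\<bar>\<^sup>2)) x) \<le> 4"
    proof (rule suminf_le_const)
      fix N
      have "(\<Sum>k<N. nn_cond_exp M (F k) (\<lambda>y. ennreal (\<bar>mart_diff M F (Suc k) (\<lambda>y. multiplier y * f y) y\<bar>\<^sup>2)) x)
          \<le> (\<Sum>k<N. ennreal (4 * (weight k x - weight (Suc k) x)))"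
        using elim by (intro sum_mono) auto
      also have "\<dots> = ennreal (\<Sum>k<N. 4 * (weight k x - weight (Suc k) x))"
        using decseq_SucD[OF weight_decseq[of x]] by (intro sum_ennreal) simp
      also have "(\<Sum>k<N. 4 * (weight k x - weight (Suc k) x)) = 4 * (\<Sum>k<N. weight k x - weight (Suc k) x)"
        by (rule sum_distrib_left[symmetric])
      also have "(\<Sum>k<N. weight k x - weight (Suc k) x) = weight 0 x - weight N x"
        by (rule sum_lessThan_telescope')
      also have "ennreal (4 * (weight 0 x - weight N x)) \<le> ennreal 4"
        using weight_bounds(1)[of N x] by (intro ennreal_leI) (simp add: weight_def[of 0])
      finally show "(\<Sum>k<N. nn_cond_exp M (F k) (\<lambda>y. ennreal (\<bar>mart_diff M F (Suc k) (\<lambda>y. multiplier y * f y) y\<bar>\<^sup>2)) x) \<le> 4"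
        by simp
    qed simp
    then show ?case
      by (simp add: cond_square_fun_def ennreal_sqrt_squared)
  qed
qed

section \<open>The mean\<close>

text \<open>
  The mean of \<open>multiplier * f\<close> is that of the initial quasi-mean, and \<open>\<phi> t \<le> t\<close>.
\<close>
lemma mean_lower_bound: "(\<integral>x. \<phi> (f x) \<partial>M) \<le> (\<integral>x. multiplier x * f x \<partial>M)"
proof -
  have int: "integrable M (E 0 (\<lambda>x. \<phi> (f x)))" "integrable M (E 0 (\<lambda>x. multiplier x * f x))"
    by (auto intro!: cond.real_cond_exp_int)
  have "(\<integral>x. \<phi> (f x) \<partial>M) = (\<integral>x. E 0 (\<lambda>x. \<phi> (f x)) x \<partial>M)"
    by (rule cond.real_cond_exp_int(2)[symmetric]) simp
  also have "\<dots> \<le> (\<integral>x. E 0 (\<lambda>x. multiplier x * f x) x \<partial>M)"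
  proof (rule integral_mono_AE[OF int])
    show "AE x in M. E 0 (\<lambda>x. \<phi> (f x)) x \<le> E 0 (\<lambda>x. multiplier x * f x) x"
      using quasi_mean_props[of 0] cond_exp_product[of 0]
    proof eventually_elim
      case (elim x)
      have "\<phi> (quasi_mean 0 x) \<le> quasi_mean 0 x" by (simp add: \<phi>_def)
      with elim show ?case by (simp add: weight_def)
    qed
  qed
  also have "\<dots> = (\<integral>x. multiplier x * f x \<partial>M)"
    by (rule cond.real_cond_exp_int(2)) simp
  finally show ?thesis .
qed

lemma Linf_norm_props:
  shows "0 \<le> Linf_norm M f" "Linf_norm M f \<le> 1" "AE x in M. f x \<le> Linf_norm M f"
proof -
  let ?e = "esssup M (\<lambda>x. ereal \<bar>f x\<bar>)"
  have le: "?e \<le> 1"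
    by (rule esssup_I) (use f_bounds in \<open>auto simp: one_ereal_def\<close>)
  have "0 = esssup M (\<lambda>x. 0 :: ereal)"
    by (rule esssup_const[symmetric]) (simp add: emeasure_space_1)
  also have "\<dots> \<le> ?e"
    by (rule esssup_mono) auto
  finally have ge: "0 \<le> ?e" .
  have eq: "ereal (Linf_norm M f) = ?e"
    unfolding Linf_norm_def using le ge by (intro ereal_real') auto
  show "0 \<le> Linf_norm M f" "Linf_norm M f \<le> 1"
    using le ge unfolding eq[symmetric] by (auto simp: one_ereal_def zero_ereal_def)
  have "AE x in M. ereal \<bar>f x\<bar> \<le> ereal (Linf_norm M f)"
    unfolding eq by (rule esssup_AE)
  then show "AE x in M. f x \<le> Linf_norm M f"
    by eventually_elim auto
qed

text \<open>
  The quotient \<open>\<phi> t / t = 1 - t / 4\<close> is least at \<open>t = a\<close>, where \<open>exp (- a) \<le> 1 / (1 + a)\<close> suffices.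
\<close>
lemma \<phi>_lower_bound:
  assumes "0 \<le> t" "t \<le> a" "a \<le> 1"
  shows "exp (- a) * t \<le> \<phi> t"
proof -
  have "1 \<le> (1 - a / 4) * (1 + a)"
    using assms mult_nonneg_nonneg[of a "3 - a"] by (simp add: algebra_simps)
  also have "\<dots> \<le> (1 - a / 4) * exp a"
    using assms by (intro mult_left_mono) (auto simp: exp_ge_add_one_self)
  finally have "exp (- a) \<le> 1 - a / 4"
    by (simp add: exp_minus field_simps)
  also have "\<dots> \<le> 1 - t / 4" using assms by simp
  finally have "exp (- a) * t \<le> (1 - t / 4) * t"
    using assms by (intro mult_right_mono) auto
  then show ?thesis by (simp add: \<phi>_def power2_eq_square algebra_simps)
qed

lemma mean_lower_bound_exp: "exp (- Linf_norm M f) * (\<integral>x. f x \<partial>M) \<le> (\<integral>x. multiplier x * f x \<partial>M)"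
proof -
  have f: "integrable M f"
    by (rule integrable_unit_interval) (use f_bounds in auto)
  have "exp (- Linf_norm M f) * (\<integral>x. f x \<partial>M) = (\<integral>x. exp (- Linf_norm M f) * f x \<partial>M)"
    by simp
  also have "\<dots> \<le> (\<integral>x. \<phi> (f x) \<partial>M)"
  proof (rule integral_mono_AE)
    show "AE x in M. exp (- Linf_norm M f) * f x \<le> \<phi> (f x)"
      using Linf_norm_props(3) f_AE_bounds
      by eventually_elim (auto intro: \<phi>_lower_bound Linf_norm_props(2))
  qed (use f in auto)
  also note mean_lower_bound
  finally show ?thesis .
qed

end

theorem theorem1:
  fixes M :: "'a measure" and F :: "nat \<Rightarrow> 'a measure" and f :: "'a \<Rightarrow> real"
  assumes "filtered_prob_space M F"
    and "f \<in> borel_measurable M"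
    and "\<And>x. x \<in> space M \<Longrightarrow> 0 \<le> f x \<and> f x \<le> 1"
  shows "\<exists>m :: 'a \<Rightarrow> real. m \<in> borel_measurable M \<and> (\<forall>x\<in>space M. 0 \<le> m x \<and> m x \<le> 1) \<and>
    (\<integral>x. m x * f x \<partial>M) \<ge> exp (- Linf_norm M f) * (\<integral>x. f x \<partial>M) \<and>
    (AE x in M. (cond_square_fun M F (\<lambda>y. m y * f y) x)\<^sup>2 \<le> 18)"
proof -
  interpret bounded_target M F f
    using assms by (simp add: bounded_target_def bounded_target_axioms_def)
  have "AE x in M. (cond_square_fun M F (\<lambda>y. multiplier y * f y) x)\<^sup>2 \<le> 18"
    using square_function_bound by eventually_elim (erule order_trans, simp)
  then show ?thesis
    using multiplier_measurable multiplier_bounds mean_lower_bound_exp by blast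
qed

end
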